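(* Let $\mu,\nu$ be Borel probability measures on $\mathbb{R}$ with finite first moment and let $q$ be a Borel probability measure on $\mathbb{R}$ absolutely continuous with respect to Lebesgue measure, with density $\rho_q$. Then a $q$-Bass martingale from $\mu$ to $\nu$ exists if and only if there exists a Borel probability measure $\alpha$ on $\mathbb{R}$ such that $$\int_{\mathbb{R}}Q_\nu\left(\int_0^1F_q\bigl(Q_\alpha(u)-Q_\alpha(v)+z\bigr)\,dv\right)\rho_q(z)\,dz=Q_\mu(u)\qquad\text{for Lebesgue-a.e. }u\in(0,1),$$ and $S_\alpha:=q\star T_\alpha$ is increasing $\alpha$-a.s., where $T_\alpha=Q_\nu\circ F_{\alpha\ast q}$.
   Context: Notation. For a Borel probability measure $\xi$ on $\mathbb{R}$, $F_\xi$ is its cumulative distribution function and $Q_\xi(u)=\inf\{y\in\mathbb{R}:F_\xi(y)\ge u\}$, $u\in(0,1)$, its left-continuous quantile function, extended by $Q_\xi(0)=\inf(\mathrm{supp}(\xi))$, $Q_\xi(1)=\sup(\mathrm{supp}(\xi))$. $\alpha\ast q$ denotes the convolution of the measures $\alpha$ and $q$, and for a measurable function $T$, $(q\star T)(x)=\int_{\mathbb{R}}T(x+y)\,q(dy)$. $\mathscr{M}(\mu,\nu)$ is the set of martingale couplings of $\mu$ and $\nu$, i.e. probability measures $\pi(dx,dy)=\mu(dx)\pi_x(dy)$ on $\mathbb{R}^2$ with first marginal $\mu$, second marginal $\nu$ and $\int y\,\pi_x(dy)=x$ for $\mu$-a.e. $x$. $q$-Bass martingale. A measure $\pi\in\mathscr{M}(\mu,\nu)$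 is called a $q$-Bass martingale (from $\mu$ to $\nu$) if there is a Borel probability measure $\alpha$ on $\mathbb{R}$ (called a Bass measure) such that, with $T=Q_\nu\circ F_{\alpha\ast q}$ and $X_0\sim\alpha$, $Y\sim q$ independent, $\pi$ is the law of $(M_0,M_1)$ where $M_0=(q\star T)(X_0)$, $M_1=T(X_0+Y)$, and $q\star T$ is increasing $\alpha$-a.s. A function is increasing $\alpha$-a.s. if it is strictly increasing on a Borel set of full $\alpha$-measure. (The function $q\star T$ is defined $\alpha$-a.e.) *)

theory Defs
  imports "HOL-Probability.Probability"
begin

definition msupport :: "real measure \<Rightarrow> real set" where
  "msupport M = {x. \<forall>U. open U \<longrightarrow> x \<in> U \<longrightarrow> emeasure M U > 0}"

text \<open>
  The left-continuous quantile function on \<open>[0, 1]\<close>. It takes values in the extended reals because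
  the values at 0 and 1 are infinite for a measure with unbounded support; on the open interval
  \<open>(0, 1)\<close> it is finite. Arguments outside \<open>[0, 1]\<close> have no meaning.
\<close>

definition quantile :: "real measure \<Rightarrow> real \<Rightarrow> ereal" where
  "quantile M u =
     (if u = 0 then Inf (ereal ` msupport M)
      else if u = 1 then Sup (ereal ` msupport M)
      else Inf (ereal ` {y. u \<le> cdf M y}))"

text \<open>
  A martingale coupling carries its disintegration \<open>\<pi>(dx, dy) = \<mu>(dx) \<kappa> x (dy)\<close>: the measure
  \<open>distr (\<kappa> x) (borel \<Otimes>\<^sub>M borel) (Pair x)\<close> is the product of the Dirac measure at \<open>x\<close> with \<open>\<kappa> x\<close>.
\<close>

definition martingale_couplings :: "real measure \<Rightarrow> real measure \<Rightarrow> (real \<times> real) measure set" where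
  "martingale_couplings \<mu> \<nu> =
     {\<pi>. prob_space \<pi> \<and> sets \<pi> = sets (borel \<Otimes>\<^sub>M borel) \<and>
         distr \<pi> borel fst = \<mu> \<and> distr \<pi> borel snd = \<nu> \<and>
         (\<exists>\<kappa> \<in> borel \<rightarrow>\<^sub>M prob_algebra borel.
            \<pi> = \<mu> \<bind> (\<lambda>x. distr (\<kappa> x) (borel \<Otimes>\<^sub>M borel) (Pair x)) \<and>
            (AE x in \<mu>. has_bochner_integral (\<kappa> x) (\<lambda>y. y) x))}"

text \<open>
  The function \<open>q \<star> T\<close>. It is a Bochner integral, hence 0 at those \<open>x\<close> at which
  \<open>\<lambda>y. T (x + y)\<close> is not \<open>q\<close>-integrable.
\<close>

definition star_fun :: "real measure \<Rightarrow> (real \<Rightarrow> real) \<Rightarrow> real \<Rightarrow> real" where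
  "star_fun q T x = (\<integral>y. T (x + y) \<partial>q)"

text \<open>
  The map \<open>T = Q\<^sub>\<nu> \<circ> F\<^bsub>\<alpha>*q\<^esub>\<close>. For \<open>q\<close> without atoms the values of \<open>F\<^bsub>\<alpha>*q\<^esub>\<close> lie in \<open>(0, 1)\<close>
  almost everywhere with respect to \<open>\<alpha>*q\<close>, so passing from the extended reals to the reals
  changes \<open>T\<close> only on a null set of that measure.
\<close>

definition bass_map :: "real measure \<Rightarrow> real measure \<Rightarrow> real measure \<Rightarrow> real \<Rightarrow> real" where
  "bass_map \<nu> q \<alpha> x = real_of_ereal (quantile \<nu> (cdf (\<alpha> \<star> q) x))"

definition increasing_as :: "real measure \<Rightarrow> (real \<Rightarrow> real) \<Rightarrow> bool" where
  "increasing_as \<alpha> f \<longleftrightarrow> (\<exists>A \<in> sets borel. measure \<alpha> A = 1 \<and> strict_mono_on A f)"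

definition q_bass_martingale ::
  "real measure \<Rightarrow> real measure \<Rightarrow> real measure \<Rightarrow> (real \<times> real) measure \<Rightarrow> bool" where
  "q_bass_martingale q \<mu> \<nu> \<pi> \<longleftrightarrow>
     \<pi> \<in> martingale_couplings \<mu> \<nu> \<and>
     (\<exists>\<alpha>. real_distribution \<alpha> \<and>
        (let T = bass_map \<nu> q \<alpha> in
           \<pi> = distr (\<alpha> \<Otimes>\<^sub>M q) (borel \<Otimes>\<^sub>M borel) (\<lambda>(x, y). (star_fun q T x, T (x + y))) \<and>
           increasing_as \<alpha> (star_fun q T)))"

end

theory Submission
  imports Defs
begin

text \<open>
  Write \<open>S = q \<star> T\<close> with \<open>T = Q\<^sub>\<nu> \<circ> F\<^bsub>\<alpha>*q\<^esub>\<close>. Since \<open>Q\<^sub>\<alpha>\<close> carries the uniform law on \<open>(0, 1)\<close> to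
  \<open>\<alpha>\<close>, the inner integral \<open>\<integral>\<^sub>0\<^sup>1 F\<^sub>q (Q\<^sub>\<alpha> u - Q\<^sub>\<alpha> v + z) dv\<close> is just \<open>F\<^bsub>\<alpha>*q\<^esub> (Q\<^sub>\<alpha> u + z)\<close>
  (\<open>LBINT_cdf_quantile\<close>). The equation of the theorem therefore says that \<open>S (Q\<^sub>\<alpha> u) = Q\<^sub>\<mu> u\<close> for almost
  every \<open>u\<close>, together with the integrability that makes the left-hand side a genuine integral. On the
  other side, the law of \<open>(S X, T (X + Y))\<close> with \<open>X \<sim> \<alpha>\<close> and \<open>Y \<sim> q\<close> independent is a candidate for a
  \<open>q\<close>-Bass martingale, and the only thing that may fail is its first marginal, the law of \<open>S X\<close>. So both
  sides reduce to the condition that \<open>S\<close> transports \<open>\<alpha>\<close> to \<open>\<mu>\<close>, for an \<open>\<alpha>\<close> such that \<open>S\<close> is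
  increasing \<open>\<alpha>\<close>-almost surely.

  For the equation (\<open>bass_equation_iff_marginal\<close>): if \<open>S \<circ> Q\<^sub>\<alpha> = Q\<^sub>\<mu>\<close> almost everywhere, both sides have
  the same law under the uniform measure, and these laws are \<open>S\<^sub>#\<alpha>\<close> and \<open>\<mu>\<close>. Conversely \<open>S \<circ> Q\<^sub>\<alpha>\<close> is
  nondecreasing on a set of full measure, and a nondecreasing function on \<open>(0, 1)\<close> whose law is \<open>\<mu>\<close>
  agrees almost everywhere with \<open>Q\<^sub>\<mu>\<close> (\<open>mono_representation_eq_quantile\<close>).

  For the coupling (\<open>martingale_coupling_star_fun\<close>): as \<open>S\<close> is injective on a set of full measure, the
  value of \<open>S X\<close> determines \<open>X\<close>, so conditioning \<open>T (X + Y)\<close> on \<open>S X\<close> is the same as conditioning it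
  on \<open>X\<close>. The conditional mean of \<open>T (X + Y)\<close> given \<open>X\<close> is \<open>S X\<close> by the definition of \<open>S\<close>, which is the
  martingale property. The second marginal is \<open>\<nu>\<close> because \<open>\<alpha>*q\<close> has no atoms (\<open>distr_bass_map\<close>), and
  the integrability of \<open>T (a + Y)\<close> for \<open>\<alpha>\<close>-almost every \<open>a\<close> follows, by Fubini, from the finite first
  moment of \<open>\<nu>\<close>.
\<close>

section \<open>Quantile functions and the uniform law\<close>

abbreviation Q :: "real measure \<Rightarrow> real \<Rightarrow> real" where
  "Q M u \<equiv> real_of_ereal (quantile M u)"

abbreviation leb01 :: "real measure" where
  "leb01 \<equiv> restrict_space lborel {0<..<1}"

lemma prob_space_leb01: "prob_space leb01"
  by (auto simp: space_restrict_space emeasure_restrict_space intro!: prob_spaceI)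

lemma AE_leb01_iff: "(AE u in leb01. P u) \<longleftrightarrow> (AE u in lborel. 0 < u \<and> u < 1 \<longrightarrow> P u)"
  by (subst AE_restrict_space_iff) auto

lemma quantile_eq_ereal_Inf:
  assumes "real_distribution M" and u: "0 < u" "u < 1"
  shows "quantile M u = ereal (Inf {y. u \<le> cdf M y})"
proof -
  interpret cdf_distribution M by (simp add: cdf_distribution_def assms)
  define a where "a = I u"
  have "{y. u \<le> C y} = {a..}"
    using pseudoinverse[OF u] unfolding a_def by blast
  moreover have "Inf (ereal ` {a..}) = ereal a"
    by (rule antisym) (auto intro!: Inf_lower Inf_greatest)
  ultimately have "quantile M u = ereal a"
    using u by (simp add: quantile_def)
  then show ?thesis
    by (simp add: a_def)
qed

lemma Q_le_iff:
  assumes "real_distribution M" and u: "0 < u" "u < 1"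
  shows "Q M u \<le> y \<longleftrightarrow> u \<le> cdf M y"
proof -
  interpret cdf_distribution M by (simp add: cdf_distribution_def assms)
  show ?thesis
    using pseudoinverse[OF u, of y] by (simp add: quantile_eq_ereal_Inf[OF assms])
qed

lemma Q_mono:
  assumes "real_distribution M" and "0 < u" "u \<le> v" "v < 1"
  shows "Q M u \<le> Q M v"
  using Q_le_iff[OF assms(1), of u "Q M v"] Q_le_iff[OF assms(1), of v "Q M v"] assms by auto

text \<open>
  Only the monotone part on \<open>(0, 1)\<close> matters: outside \<open>[0, 1]\<close> the quantile is infinite, which becomes
  \<open>0\<close> in the reals, and the two end points are single values.
\<close>

lemma borel_measurable_Q:
  assumes "real_distribution M"
  shows "Q M \<in> borel_measurable borel"
proof -
  have "mono_on {0<..<1} (Q M)"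
    by (auto simp: mono_on_def intro: Q_mono[OF assms])
  then have "Q M \<in> borel_measurable (restrict_space borel {0<..<1})"
    by (rule borel_measurable_mono_on_fnc)
  then have [measurable]: "(\<lambda>u. if u \<in> {0<..<1} then Q M u else 0) \<in> borel_measurable borel"
    by (subst (asm) measurable_restrict_space_iff[where c=0]) auto
  interpret real_distribution M by (fact assms)
  have below: "Q M u = 0" if "u < 0" for u
  proof -
    have "{y. u \<le> cdf M y} = UNIV"
      using that cdf_nonneg by (auto intro: order_trans[OF less_imp_le])
    moreover have "Inf (range ereal) = -\<infinity>"
      by (rule ereal_bot) (auto intro: Inf_lower)
    ultimately show ?thesis
      using that by (simp add: quantile_def)
  qed
  have above: "Q M u = 0" if "1 < u" for u
  proof -
    have "{y. u \<le> cdf M y} = {}"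
      using that cdf_bounded_prob by (auto simp: not_le intro: le_less_trans)
    then show ?thesis
      using that by (simp add: quantile_def top_ereal_def)
  qed
  have "Q M = (\<lambda>u. if u = 0 then Q M 0 else if u = 1 then Q M 1 else if u \<in> {0<..<1} then Q M u else 0)"
    using below above by (auto simp: fun_eq_iff not_less)
  also have "\<dots> \<in> borel_measurable borel"
    by measurable
  finally show ?thesis .
qed

lemma distr_Q:
  assumes "real_distribution M"
  shows "distr leb01 borel (Q M) = M"
proof -
  interpret cdf_distribution M by (simp add: cdf_distribution_def assms)
  have "distr leb01 borel (Q M) = distr leb01 borel I"
    by (intro distr_cong) (auto simp: space_restrict_space quantile_eq_ereal_Inf[OF assms])
  then show ?thesis
    by (simp add: distr_I_eq_M)
qed

lemma AE_Q:
  assumes "real_distribution M" and "AE x in M. P x"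
  shows "AE u in leb01. P (Q M u)"
proof (rule AE_distrD[where M'=borel and f="Q M"])
  show "Q M \<in> leb01 \<rightarrow>\<^sub>M borel"
    using borel_measurable_Q[OF assms(1)] by (simp add: measurable_restrict_space1)
  show "AE x in distr leb01 borel (Q M). P x"
    by (subst distr_Q[OF assms(1)]) (fact assms(2))
qed

text \<open>
  Without atoms the distribution function is continuous, so it cannot jump over the level \<open>u\<close> at the
  point where it first reaches it.
\<close>

lemma cdf_Q:
  assumes M: "real_distribution M" and atomless: "\<And>x. measure M {x} = 0" and u: "0 < u" "u < 1"
  shows "cdf M (Q M u) = u"
proof (rule antisym)
  interpret real_distribution M by (fact M)
  have "cdf M y \<le> u" if "y < Q M u" for y
    using that Q_le_iff[OF M u, of y] by auto
  moreover have "(cdf M \<longlongrightarrow> cdf M (Q M u)) (at_left (Q M u))"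
    using isCont_cdf[of "Q M u"] atomless by (simp add: isCont_def filterlim_at_split)
  ultimately show "cdf M (Q M u) \<le> u"
    by (intro tendsto_upperbound) (auto simp: eventually_at_filter)
  show "u \<le> cdf M (Q M u)"
    using Q_le_iff[OF M u, of "Q M u"] by simp
qed

text \<open>
  Sampling \<open>M\<close> as \<open>Q\<^sub>M\<close> of a uniform variable turns \<open>Q\<^sub>N \<circ> F\<^sub>M\<close> into \<open>Q\<^sub>N\<close> of the same variable.
\<close>

lemma distr_quantile_transform:
  assumes M: "real_distribution M" and atomless: "\<And>x. measure M {x} = 0" and N: "real_distribution N"
  shows "distr M borel (\<lambda>x. Q N (cdf M x)) = N"
proof -
  interpret cdf_distribution M by (simp add: cdf_distribution_def M)
  note [measurable] = borel_measurable_Q[OF M] borel_measurable_Q[OF N]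
  have "distr M borel (\<lambda>x. Q N (cdf M x)) = distr (distr leb01 borel (Q M)) borel (\<lambda>x. Q N (cdf M x))"
    by (simp add: distr_Q[OF M])
  also have "\<dots> = distr leb01 borel (\<lambda>u. Q N (cdf M (Q M u)))"
    by (subst distr_distr) (auto simp: comp_def intro!: measurable_restrict_space1)
  also have "\<dots> = distr leb01 borel (Q N)"
    by (intro distr_cong) (auto simp: space_restrict_space cdf_Q[OF M atomless])
  finally show ?thesis
    by (simp add: distr_Q[OF N])
qed

text \<open>
  Uniqueness of the monotone rearrangement. By monotonicity \<open>g \<le> g u\<close> on almost all of \<open>(0, u]\<close>, so
  \<open>F\<^sub>M (g u) \<ge> u\<close> and hence \<open>g u \<ge> Q\<^sub>M u\<close>. Two functions with the same law have the same integral, which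
  is finite by the first moment of \<open>M\<close>, so this inequality is an equality almost everywhere.
\<close>

lemma mono_representation_eq_quantile:
  assumes M: "real_distribution M" and int: "integrable M (\<lambda>x. x)"
    and g[measurable]: "g \<in> borel_measurable borel" and law: "distr leb01 borel g = M"
    and B: "AE u in leb01. u \<in> B" and mono: "mono_on B g"
  shows "AE u in leb01. g u = Q M u"
proof -
  interpret U: prob_space leb01 by (rule prob_space_leb01)
  interpret real_distribution M by (fact M)
  note [measurable] = borel_measurable_Q[OF M]
  have g01[measurable]: "g \<in> borel_measurable leb01" and Q01[measurable]: "Q M \<in> borel_measurable leb01"
    by (auto intro!: measurable_restrict_space1)
  have ge: "Q M u \<le> g u" if u: "u \<in> B" "0 < u" "u < 1" for u
  proof -
    have "u = measure leb01 {0<..u}"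
      using u by (subst measure_restrict_space) auto
    also have "\<dots> \<le> measure leb01 {v \<in> space leb01. g v \<le> g u}"
    proof (rule U.finite_measure_mono_AE)
      show "AE v in leb01. v \<in> {0<..u} \<longrightarrow> v \<in> {v \<in> space leb01. g v \<le> g u}"
        using B AE_space by eventually_elim (use u mono_onD[OF mono] in auto)
    qed measurable
    also have "\<dots> = cdf (distr leb01 borel g) (g u)"
      unfolding cdf_def by (subst measure_distr) (auto intro!: arg_cong[where f="measure leb01"])
    finally show ?thesis
      using Q_le_iff[OF M u(2,3)] by (simp add: law)
  qed
  have id: "(\<lambda>x::real. x) \<in> borel_measurable borel"
    by simp
  have int_g: "integrable leb01 g" and int_Q: "integrable leb01 (Q M)"
    using int integrable_distr_eq[OF g01 id] integrable_distr_eq[OF Q01 id]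
    by (metis law, metis distr_Q[OF M])
  have "integral\<^sup>L leb01 g = integral\<^sup>L M (\<lambda>x. x)" "integral\<^sup>L leb01 (Q M) = integral\<^sup>L M (\<lambda>x. x)"
    using integral_distr[OF g01 id] integral_distr[OF Q01 id]
    by (metis law, metis distr_Q[OF M])
  then have integrals_eq: "integral\<^sup>L leb01 g = integral\<^sup>L leb01 (Q M)"
    by simp
  have "AE u in leb01. g u - Q M u = 0"
  proof (subst integral_nonneg_eq_0_iff_AE[symmetric])
    show "integrable leb01 (\<lambda>u. g u - Q M u)"
      using int_g int_Q by simp
    show "AE u in leb01. 0 \<le> g u - Q M u"
      using B AE_space by eventually_elim (use ge in \<open>auto simp: space_restrict_space\<close>)
    show "(\<integral>u. g u - Q M u \<partial>leb01) = 0"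
      using int_g int_Q integrals_eq by simp
  qed
  then show ?thesis by simp
qed

section \<open>A Borel inverse of an increasing function\<close>

text \<open>
  The image of \<open>A\<close> may fail to be Borel, so the inverse is defined on the whole line as
  \<open>x \<mapsto> Sup {a \<in> A. f a \<le> x}\<close>, which is measurable because it is monotone.
\<close>

lemma strict_mono_on_borel_left_inverse:
  fixes f :: "real \<Rightarrow> real"
  assumes "strict_mono_on A f"
  obtains g where "g \<in> borel_measurable borel" "\<And>a. a \<in> A \<Longrightarrow> g (f a) = a"
proof -
  \<comment> \<open>The arctangent keeps the supremum finite; \<open>-2\<close> lies below its range and makes the set nonempty.\<close>
  define E where "E x = insert (-2) (arctan ` {a \<in> A. f a \<le> x})" for x
  have bdd: "bdd_above (E x)" for x
  proof (rule bdd_aboveI)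
    fix y assume "y \<in> E x"
    moreover have "arctan b \<le> 2" for b
      using arctan_ubound[of b] pi_half_less_two by linarith
    ultimately show "y \<le> 2"
      by (auto simp: E_def)
  qed
  define h where "h x = Sup (E x)" for x
  have "mono h"
    unfolding h_def by (intro monoI cSup_subset_mono bdd) (auto simp: E_def)
  then have [measurable]: "h \<in> borel_measurable borel"
    by (rule borel_measurable_mono)
  have "h (f a) = arctan a" if "a \<in> A" for a
    unfolding h_def
  proof (rule cSup_eq_maximum)
    show "arctan a \<in> E (f a)" using that by (auto simp: E_def)
    fix y assume "y \<in> E (f a)"
    moreover have "-2 \<le> arctan a"
      using arctan_lbound[of a] pi_half_less_two by auto
    moreover have "a' \<le> a" if "a' \<in> A" "f a' \<le> f a" for a'
      using strict_mono_onD[OF assms \<open>a \<in> A\<close> \<open>a' \<in> A\<close>] that by force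
    ultimately show "y \<le> arctan a"
      by (auto simp: E_def arctan_le_iff)
  qed
  moreover have "(\<lambda>x. tan (h x)) \<in> borel_measurable borel"
    unfolding tan_def by measurable
  ultimately show thesis
    by (intro that[of "\<lambda>x. tan (h x)"]) (auto simp: tan_arctan)
qed


section \<open>Convolutions and the map \<open>T\<close>\<close>

lemma real_distribution_convolution:
  assumes "real_distribution \<alpha>" "real_distribution q"
  shows "real_distribution (\<alpha> \<star> q)"
proof -
  interpret A: real_distribution \<alpha> by fact
  interpret B: real_distribution q by fact
  interpret pair_prob_space \<alpha> q ..
  have "prob_space (\<alpha> \<star> q)"
    unfolding convolution_def by (rule prob_space_distr) measurable
  then show ?thesis
    by (simp add: real_distribution_def real_distribution_axioms_def)
qed

lemma measure_convolution:
  assumes "real_distribution \<alpha>" "real_distribution q" and [measurable]: "X \<in> sets borel"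
  shows "measure (\<alpha> \<star> q) X = (\<integral>a. measure q {y. y + a \<in> X} \<partial>\<alpha>)"
proof -
  interpret A: real_distribution \<alpha> by fact
  interpret B: real_distribution q by fact
  interpret real_distribution "\<alpha> \<star> q"
    by (intro real_distribution_convolution assms)
  have [measurable]: "{y. y + a \<in> X} \<in> sets borel" for a
    by measurable
  have [measurable]: "(\<lambda>a. measure q {y. y + a \<in> X}) \<in> borel_measurable borel"
    by measurable
  have "ennreal (measure (\<alpha> \<star> q) X) = emeasure (\<alpha> \<star> q) X"
    by (simp add: emeasure_eq_measure)
  also have "\<dots> = (\<integral>\<^sup>+a. emeasure q {y. y + a \<in> X} \<partial>\<alpha>)"
    by (rule convolution_emeasure) (auto intro: A.finite_measure_axioms B.finite_measure_axioms)
  also have "\<dots> = (\<integral>\<^sup>+a. ennreal (measure q {y. y + a \<in> X}) \<partial>\<alpha>)"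
    by (simp add: B.emeasure_eq_measure)
  also have "\<dots> = ennreal (\<integral>a. measure q {y. y + a \<in> X} \<partial>\<alpha>)"
    by (rule nn_integral_eq_integral) (auto intro!: A.integrable_const_bound[where B=1])
  finally show ?thesis
    by (subst (asm) ennreal_inj) (auto intro!: integral_nonneg_AE)
qed

lemma cdf_convolution:
  assumes "real_distribution \<alpha>" "real_distribution q"
  shows "cdf (\<alpha> \<star> q) c = (\<integral>a. cdf q (c - a) \<partial>\<alpha>)"
proof -
  have "{y. y + a \<in> {..c}} = {..c - a}" for a
    by auto
  then show ?thesis
    by (simp add: cdf_def measure_convolution[OF assms] del: atMost_iff)
qed

text \<open>
  As \<open>Q\<^sub>\<alpha>\<close> transports the uniform law to \<open>\<alpha>\<close>, the integral over \<open>v\<close> is the integral of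
  \<open>F\<^sub>q (b + z - a)\<close> against \<open>\<alpha>(da)\<close>.
\<close>

lemma LBINT_cdf_quantile:
  assumes "real_distribution \<alpha>" "real_distribution q"
  shows "(LBINT v=0..1. cdf q (b - Q \<alpha> v + z)) = cdf (\<alpha> \<star> q) (b + z)"
proof -
  interpret q: cdf_distribution q by (simp add: cdf_distribution_def assms)
  have Q01[measurable]: "Q \<alpha> \<in> borel_measurable leb01"
    using borel_measurable_Q[OF assms(1)] by (auto intro!: measurable_restrict_space1)
  have "(LBINT v=0..1. cdf q (b - Q \<alpha> v + z)) = (\<integral>v. cdf q (b + z - Q \<alpha> v) \<partial>leb01)"
    by (simp add: interval_lebesgue_integral_def zero_ereal_def one_ereal_def set_lebesgue_integral_def
        integral_restrict_space algebra_simps)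
  also have "\<dots> = (\<integral>a. cdf q (b + z - a) \<partial>(distr leb01 borel (Q \<alpha>)))"
    by (subst integral_distr) auto
  also have "\<dots> = cdf (\<alpha> \<star> q) (b + z)"
    by (simp add: distr_Q[OF assms(1)] cdf_convolution[OF assms])
  finally show ?thesis .
qed

lemma atomless_convolution:
  assumes "real_distribution \<alpha>" "real_distribution q" and "\<And>x. measure q {x} = 0"
  shows "measure (\<alpha> \<star> q) {x} = 0"
proof -
  have "{y. y + a \<in> {x}} = {x - a}" for a
    by auto
  then show ?thesis
    by (simp add: measure_convolution[OF assms(1,2)] assms(3) del: singleton_iff)
qed

lemma borel_measurable_bass_map:
  assumes "real_distribution \<nu>" "real_distribution \<alpha>" "real_distribution q"
  shows "bass_map \<nu> q \<alpha> \<in> borel_measurable borel"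
proof -
  interpret cdf_distribution "\<alpha> \<star> q"
    using assms by (simp add: cdf_distribution_def real_distribution_convolution)
  show ?thesis
    using measurable_compose[OF measurable_C borel_measurable_Q[OF assms(1)]] by (simp add: bass_map_def[abs_def])
qed

lemma distr_bass_map:
  assumes "real_distribution \<nu>" "real_distribution \<alpha>" "real_distribution q" and "\<And>x. measure q {x} = 0"
  shows "distr (\<alpha> \<star> q) borel (bass_map \<nu> q \<alpha>) = \<nu>"
  unfolding bass_map_def[abs_def]
  by (intro distr_quantile_transform real_distribution_convolution atomless_convolution assms)

lemma borel_measurable_star_fun:
  assumes "real_distribution q" and [measurable]: "T \<in> borel_measurable borel"
  shows "star_fun q T \<in> borel_measurable borel"
proof -
  interpret real_distribution q by fact
  show ?thesis
    unfolding star_fun_def[abs_def] by measurable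
qed

lemma AE_integrable_translate:
  fixes T :: "real \<Rightarrow> real"
  assumes "real_distribution \<alpha>" "real_distribution q" and [measurable]: "T \<in> borel_measurable borel"
    and "integrable (\<alpha> \<star> q) T"
  shows "AE a in \<alpha>. integrable q (\<lambda>y. T (a + y))"
proof -
  interpret A: real_distribution \<alpha> by fact
  interpret B: real_distribution q by fact
  interpret pair_prob_space \<alpha> q ..
  have "integrable (\<alpha> \<Otimes>\<^sub>M q) (\<lambda>(a, y). T (a + y))"
  proof -
    have "(\<lambda>(a, y). a + y) \<in> borel_measurable (\<alpha> \<Otimes>\<^sub>M q)"
      by measurable
    from integrable_distr_eq[OF this assms(3)] show ?thesis
      using assms(4) by (simp add: convolution_def case_prod_unfold)
  qed
  then show ?thesis
    by (rule AE_integrable_fst)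
qed

section \<open>The martingale coupling\<close>

lemma AE_in_full_measure_set:
  assumes "real_distribution \<alpha>" "A \<in> sets borel" "measure \<alpha> A = 1"
  shows "AE a in \<alpha>. a \<in> A"
proof -
  interpret real_distribution \<alpha> by fact
  show ?thesis
    using assms by (subst AE_in_set_eq_1) auto
qed

lemma pair_distr_eq_bind:
  assumes "prob_space \<alpha>" "prob_space q" and [measurable_cong]: "sets \<alpha> = sets borel" "sets q = sets borel"
    and [measurable]: "S \<in> borel_measurable borel" "T \<in> borel_measurable borel"
  shows "distr (\<alpha> \<Otimes>\<^sub>M q) (borel \<Otimes>\<^sub>M borel) (\<lambda>(x::real, y::real). (S x :: real, T (x + y) :: real)) =
    \<alpha> \<bind> (\<lambda>x. distr (distr q borel (\<lambda>y. T (x + y))) (borel \<Otimes>\<^sub>M borel) (Pair (S x)))"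
proof -
  interpret A: prob_space \<alpha> by fact
  interpret B: prob_space q by fact
  interpret pair_prob_space \<alpha> q ..
  have q_in[measurable]: "(\<lambda>x. q) \<in> borel \<rightarrow>\<^sub>M prob_algebra borel"
    using assms by (intro measurable_const) (auto simp: space_prob_algebra)
  have K: "(\<lambda>x. distr (distr q borel (\<lambda>y. T (x + y))) (borel \<Otimes>\<^sub>M borel) (Pair (S x)))
      \<in> borel \<rightarrow>\<^sub>M prob_algebra (borel \<Otimes>\<^sub>M borel)"
    by measurable
  have K': "(\<lambda>x. distr (distr q borel (\<lambda>y. T (x + y))) (borel \<Otimes>\<^sub>M borel) (Pair (S x)))
      \<in> \<alpha> \<rightarrow>\<^sub>M subprob_algebra (borel \<Otimes>\<^sub>M borel)"
    using measurable_prob_algebraD[OF K] by (simp cong: measurable_cong_sets)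
  show ?thesis
  proof (rule measure_eqI)
    show "sets (distr (\<alpha> \<Otimes>\<^sub>M q) (borel \<Otimes>\<^sub>M borel) (\<lambda>(x, y). (S x, T (x + y)))) =
      sets (\<alpha> \<bind> (\<lambda>x. distr (distr q borel (\<lambda>y. T (x + y))) (borel \<Otimes>\<^sub>M borel) (Pair (S x))))"
      using sets_bind_measurable[OF K' A.not_empty] by simp
    fix X assume "X \<in> sets (distr (\<alpha> \<Otimes>\<^sub>M q) (borel \<Otimes>\<^sub>M borel) (\<lambda>(x, y). (S x, T (x + y))))"
    then have X[measurable]: "X \<in> sets (borel \<Otimes>\<^sub>M borel)"
      by simp
    have "emeasure (distr (\<alpha> \<Otimes>\<^sub>M q) (borel \<Otimes>\<^sub>M borel) (\<lambda>(x, y). (S x, T (x + y)))) X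
      = (\<integral>\<^sup>+z. indicator X (S (fst z), T (fst z + snd z)) \<partial>(\<alpha> \<Otimes>\<^sub>M q))"
      by (simp add: nn_integral_indicator[symmetric] nn_integral_distr case_prod_unfold del: nn_integral_indicator)
    also have "\<dots> = (\<integral>\<^sup>+x. \<integral>\<^sup>+y. indicator X (S x, T (x + y)) \<partial>q \<partial>\<alpha>)"
      by (subst B.nn_integral_fst[symmetric]) auto
    also have "\<dots> = (\<integral>\<^sup>+x. emeasure (distr (distr q borel (\<lambda>y. T (x + y))) (borel \<Otimes>\<^sub>M borel) (Pair (S x))) X \<partial>\<alpha>)"
      by (simp add: nn_integral_indicator[symmetric] nn_integral_distr del: nn_integral_indicator)
    also have "\<dots> = emeasure (\<alpha> \<bind> (\<lambda>x. distr (distr q borel (\<lambda>y. T (x + y))) (borel \<Otimes>\<^sub>M borel) (Pair (S x)))) X"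
      by (rule emeasure_bind[OF A.not_empty K' X, symmetric])
    finally show "emeasure (distr (\<alpha> \<Otimes>\<^sub>M q) (borel \<Otimes>\<^sub>M borel) (\<lambda>(x, y). (S x, T (x + y)))) X
      = emeasure (\<alpha> \<bind> (\<lambda>x. distr (distr q borel (\<lambda>y. T (x + y))) (borel \<Otimes>\<^sub>M borel) (Pair (S x)))) X" .
  qed
qed

text \<open>
  The required disintegration comes from recovering \<open>X\<close> from \<open>S X\<close>: with a Borel left inverse \<open>g\<close> of
  \<open>S\<close>, the kernel \<open>\<kappa> x\<close> is the law of \<open>T (g x + Y)\<close>, whose mean at \<open>x = S a\<close> is \<open>S a\<close>.
\<close>

lemma martingale_coupling_star_fun:
  assumes \<alpha>: "real_distribution \<alpha>" and q: "real_distribution q"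
    and T[measurable]: "T \<in> borel_measurable borel" and int: "integrable (\<alpha> \<star> q) T"
    and inc: "increasing_as \<alpha> (star_fun q T)"
  shows "distr (\<alpha> \<Otimes>\<^sub>M q) (borel \<Otimes>\<^sub>M borel) (\<lambda>(x, y). (star_fun q T x, T (x + y)))
    \<in> martingale_couplings (distr \<alpha> borel (star_fun q T)) (distr (\<alpha> \<star> q) borel T)"
proof -
  interpret A: real_distribution \<alpha> by fact
  interpret B: real_distribution q by fact
  interpret pair_prob_space \<alpha> q ..
  define S where "S = star_fun q T"
  define \<pi> where "\<pi> = distr (\<alpha> \<Otimes>\<^sub>M q) (borel \<Otimes>\<^sub>M borel) (\<lambda>(x, y). (S x, T (x + y)))"
  have S[measurable]: "S \<in> borel_measurable borel"
    unfolding S_def by (rule borel_measurable_star_fun[OF q T])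
  from inc obtain X where X: "X \<in> sets borel" "measure \<alpha> X = 1" "strict_mono_on X S"
    by (auto simp: increasing_as_def S_def)
  obtain g where g[measurable]: "g \<in> borel_measurable borel" and gS: "\<And>a. a \<in> X \<Longrightarrow> g (S a) = a"
    using strict_mono_on_borel_left_inverse[OF X(3)] by blast
  have AE_gS: "AE a in \<alpha>. g (S a) = a"
    using AE_in_full_measure_set[OF \<alpha> X(1,2)] by eventually_elim (rule gS)
  define \<kappa> where "\<kappa> x = distr q borel (\<lambda>y. T (g x + y))" for x
  have [measurable]: "(\<lambda>x. q) \<in> borel \<rightarrow>\<^sub>M prob_algebra borel"
    using B.prob_space_axioms by (intro measurable_const) (auto simp: space_prob_algebra)
  have \<kappa>: "\<kappa> \<in> borel \<rightarrow>\<^sub>M prob_algebra borel"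
    unfolding \<kappa>_def by measurable
  have prob: "prob_space \<pi>"
    unfolding \<pi>_def by (rule prob_space_distr) measurable
  have sets: "sets \<pi> = sets (borel \<Otimes>\<^sub>M borel)"
    by (simp add: \<pi>_def)
  have fst: "distr \<pi> borel fst = distr \<alpha> borel S"
  proof -
    have "distr \<pi> borel fst = distr (distr (\<alpha> \<Otimes>\<^sub>M q) \<alpha> fst) borel S"
      unfolding \<pi>_def by (subst (1 2) distr_distr) (auto simp: comp_def case_prod_unfold)
    then show ?thesis
      by (simp add: B.distr_pair_fst)
  qed
  have snd: "distr \<pi> borel snd = distr (\<alpha> \<star> q) borel T"
    unfolding \<pi>_def convolution_def by (subst (1 2) distr_distr) (auto simp: comp_def case_prod_unfold)
  have bind: "\<pi> = distr \<alpha> borel S \<bind> (\<lambda>x. distr (\<kappa> x) (borel \<Otimes>\<^sub>M borel) (Pair x))"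
  proof -
    have K: "(\<lambda>x. distr (\<kappa> x) (borel \<Otimes>\<^sub>M borel) (Pair x)) \<in> borel \<rightarrow>\<^sub>M subprob_algebra (borel \<Otimes>\<^sub>M borel)"
      by (intro measurable_prob_algebraD measurable_distr_prob_space2[OF \<kappa>]) (simp add: case_prod_unfold)
    have "distr \<alpha> borel S \<bind> (\<lambda>x. distr (\<kappa> x) (borel \<Otimes>\<^sub>M borel) (Pair x))
      = \<alpha> \<bind> (\<lambda>a. distr (\<kappa> (S a)) (borel \<Otimes>\<^sub>M borel) (Pair (S a)))"
      by (rule bind_distr[OF _ K]) (auto simp: A.not_empty)
    also have "\<dots> = \<alpha> \<bind> (\<lambda>a. distr (distr q borel (\<lambda>y. T (a + y))) (borel \<Otimes>\<^sub>M borel) (Pair (S a)))"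
    proof (rule bind_cong_AE'[where L=borel])
      show "\<alpha> \<in> space (prob_algebra borel)"
        using A.prob_space_axioms by (simp add: space_prob_algebra)
      show "(\<lambda>a. distr (\<kappa> (S a)) (borel \<Otimes>\<^sub>M borel) (Pair (S a))) \<in> borel \<rightarrow>\<^sub>M prob_algebra (borel \<Otimes>\<^sub>M borel)"
        unfolding \<kappa>_def by measurable
      show "(\<lambda>a. distr (distr q borel (\<lambda>y. T (a + y))) (borel \<Otimes>\<^sub>M borel) (Pair (S a)))
        \<in> borel \<rightarrow>\<^sub>M prob_algebra (borel \<Otimes>\<^sub>M borel)"
        by measurable
      show "AE a in \<alpha>. distr (\<kappa> (S a)) (borel \<Otimes>\<^sub>M borel) (Pair (S a))
        = distr (distr q borel (\<lambda>y. T (a + y))) (borel \<Otimes>\<^sub>M borel) (Pair (S a))"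
        using AE_gS by eventually_elim (simp add: \<kappa>_def)
    qed
    also have "\<dots> = \<pi>"
      unfolding \<pi>_def
      by (rule pair_distr_eq_bind[symmetric]) (auto intro: A.prob_space_axioms B.prob_space_axioms)
    finally show ?thesis ..
  qed
  have mart: "AE x in distr \<alpha> borel S. has_bochner_integral (\<kappa> x) (\<lambda>y. y) x"
  proof (subst AE_distr_iff)
    have [measurable]: "\<kappa> \<in> borel \<rightarrow>\<^sub>M subprob_algebra borel"
      by (rule measurable_prob_algebraD[OF \<kappa>])
    show "{x \<in> space borel. has_bochner_integral (\<kappa> x) (\<lambda>y. y) x} \<in> sets borel"
      unfolding has_bochner_integral_iff by measurable
    show "AE a in \<alpha>. has_bochner_integral (\<kappa> (S a)) (\<lambda>y. y) (S a)"
      using AE_gS AE_integrable_translate[OF \<alpha> q T int]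
    proof eventually_elim
      case (elim a)
      then have "has_bochner_integral q (\<lambda>y. T (a + y)) (S a)"
        by (simp add: has_bochner_integral_iff S_def star_fun_def)
      then show ?case
        using elim(1) by (auto simp: \<kappa>_def intro!: has_bochner_integral_distr)
    qed
  qed measurable
  have "\<pi> \<in> martingale_couplings (distr \<alpha> borel S) (distr (\<alpha> \<star> q) borel T)"
    unfolding martingale_couplings_def using prob sets fst snd \<kappa> bind mart by blast
  then show ?thesis
    by (simp add: \<pi>_def S_def)
qed

section \<open>The fixed-point equation\<close>

lemma has_bochner_integral_density_iff:
  fixes f \<rho> :: "real \<Rightarrow> real"
  assumes "f \<in> borel_measurable borel" "\<rho> \<in> borel_measurable borel" "\<And>z. 0 \<le> \<rho> z"
  shows "has_bochner_integral (density lborel (\<lambda>z. ennreal (\<rho> z))) f c \<longleftrightarrow>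
    has_bochner_integral lborel (\<lambda>z. f z * \<rho> z) c"
  using assms by (simp add: has_bochner_integral_iff integrable_density integral_density mult.commute)

lemma measure_density_lborel_singleton:
  assumes "\<rho> \<in> borel_measurable borel"
  shows "measure (density lborel (\<lambda>z. ennreal (\<rho> z))) {x :: real} = 0"
proof -
  have "emeasure (density lborel (\<lambda>z. ennreal (\<rho> z))) {x} = (\<integral>\<^sup>+z. ennreal (\<rho> z) * indicator {x} z \<partial>lborel)"
    using assms by (subst emeasure_density) auto
  also have "\<dots> = (\<integral>\<^sup>+z. 0 \<partial>(lborel :: real measure))"
    using AE_lborel_singleton[of x] by (intro nn_integral_cong_AE) (auto elim: eventually_mono)
  finally show ?thesis
    by (simp add: measure_def)
qed

text \<open>
  For almost every \<open>u\<close> the function \<open>z \<mapsto> T (Q\<^sub>\<alpha> u + z)\<close> is \<open>q\<close>-integrable with integral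
  \<open>S (Q\<^sub>\<alpha> u)\<close>, so the left-hand side states that \<open>S \<circ> Q\<^sub>\<alpha>\<close> is the quantile function of \<open>\<mu>\<close>; the first
  moment of \<open>\<mu>\<close> enters through the uniqueness of the monotone rearrangement.
\<close>

lemma bass_equation_iff_marginal:
  assumes \<mu>: "real_distribution \<mu>" "integrable \<mu> (\<lambda>x. x)"
    and \<alpha>: "real_distribution \<alpha>" and q: "real_distribution q"
    and T[measurable]: "T \<in> borel_measurable borel" and int: "integrable (\<alpha> \<star> q) T"
    and inc: "increasing_as \<alpha> (star_fun q T)"
  shows "(AE u in leb01. has_bochner_integral q (\<lambda>z. T (Q \<alpha> u + z)) (Q \<mu> u)) \<longleftrightarrow>
    distr \<alpha> borel (star_fun q T) = \<mu>"
proof -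
  interpret real_distribution \<alpha> by fact
  define S where "S = star_fun q T"
  have S[measurable]: "S \<in> borel_measurable borel"
    unfolding S_def by (rule borel_measurable_star_fun[OF q T])
  note [measurable] = borel_measurable_Q[OF \<alpha>] borel_measurable_Q[OF \<mu>(1)]
  have pointwise: "(AE u in leb01. has_bochner_integral q (\<lambda>z. T (Q \<alpha> u + z)) (Q \<mu> u)) \<longleftrightarrow>
      (AE u in leb01. S (Q \<alpha> u) = Q \<mu> u)"
    using AE_Q[OF \<alpha> AE_integrable_translate[OF \<alpha> q T int]]
    by (intro eventually_cong) (auto elim!: eventually_mono simp: has_bochner_integral_iff S_def star_fun_def)
  have law: "distr leb01 borel (\<lambda>u. S (Q \<alpha> u)) = distr \<alpha> borel S"
  proof -
    have "distr (distr leb01 borel (Q \<alpha>)) borel S = distr leb01 borel (\<lambda>u. S (Q \<alpha> u))"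
      by (subst distr_distr) (auto simp: comp_def intro!: measurable_restrict_space1)
    then show ?thesis
      by (simp add: distr_Q[OF \<alpha>])
  qed
  have "(AE u in leb01. S (Q \<alpha> u) = Q \<mu> u) \<longleftrightarrow> distr \<alpha> borel S = \<mu>"
  proof
    assume eq: "AE u in leb01. S (Q \<alpha> u) = Q \<mu> u"
    have "distr leb01 borel (\<lambda>u. S (Q \<alpha> u)) = distr leb01 borel (Q \<mu>)"
      by (rule distr_cong_AE[OF refl refl eq]) (auto intro!: measurable_restrict_space1)
    then show "distr \<alpha> borel S = \<mu>"
      by (simp add: law distr_Q[OF \<mu>(1)])
  next
    assume S_law: "distr \<alpha> borel S = \<mu>"
    from inc obtain X where X: "X \<in> sets borel" "measure \<alpha> X = 1" "strict_mono_on X S"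
      by (auto simp: increasing_as_def S_def)
    define B where "B = {u \<in> {0<..<1}. Q \<alpha> u \<in> X}"
    show "AE u in leb01. S (Q \<alpha> u) = Q \<mu> u"
    proof (rule mono_representation_eq_quantile[OF \<mu>])
      show "AE u in leb01. u \<in> B"
        using AE_Q[OF \<alpha> AE_in_full_measure_set[OF \<alpha> X(1,2)]] AE_space
        by eventually_elim (simp add: B_def space_restrict_space)
      show "mono_on B (\<lambda>u. S (Q \<alpha> u))"
        using strict_mono_on_imp_mono_on[OF X(3)] Q_mono[OF \<alpha>]
        by (auto simp: B_def mono_on_def)
    qed (auto simp: law S_law)
  qed
  with pointwise show ?thesis
    by (simp add: S_def)
qed

theorem theorem1p4:
  fixes \<mu> \<nu> q :: "real measure" and \<rho> :: "real \<Rightarrow> real"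
  assumes "real_distribution \<mu>" and "integrable \<mu> (\<lambda>x. x)"
    and "real_distribution \<nu>" and "integrable \<nu> (\<lambda>x. x)"
    and "real_distribution q"
    and "\<rho> \<in> borel_measurable borel" and "\<And>z. 0 \<le> \<rho> z"
    and "q = density lborel (\<lambda>z. ennreal (\<rho> z))"
  shows "(\<exists>\<pi>. q_bass_martingale q \<mu> \<nu> \<pi>) \<longleftrightarrow>
    (\<exists>\<alpha>. real_distribution \<alpha> \<and>
      (AE u in lborel. 0 < u \<and> u < 1 \<longrightarrow>
        has_bochner_integral lborel
          (\<lambda>z. real_of_ereal (quantile \<nu>
                  (LBINT v=0..1. cdf q (real_of_ereal (quantile \<alpha> u) - real_of_ereal (quantile \<alpha> v) + z)))
                * \<rho> z)
          (real_of_ereal (quantile \<mu> u))) \<and>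
      increasing_as \<alpha> (star_fun q (bass_map \<nu> q \<alpha>)))"
proof -
  let ?T = "bass_map \<nu> q"
  let ?S = "\<lambda>\<alpha>. star_fun q (?T \<alpha>)"
  let ?\<pi> = "\<lambda>\<alpha>. distr (\<alpha> \<Otimes>\<^sub>M q) (borel \<Otimes>\<^sub>M borel) (\<lambda>(x, y). (?S \<alpha> x, ?T \<alpha> (x + y)))"
  have atomless: "measure q {x} = 0" for x
    unfolding assms(8) by (rule measure_density_lborel_singleton[OF assms(6)])
  have T[measurable]: "?T \<alpha> \<in> borel_measurable borel" if "real_distribution \<alpha>" for \<alpha>
    using borel_measurable_bass_map[OF assms(3) that assms(5)] .
  have law_T: "distr (\<alpha> \<star> q) borel (?T \<alpha>) = \<nu>" if "real_distribution \<alpha>" for \<alpha>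
    using distr_bass_map[OF assms(3) that assms(5) atomless] .
  have int: "integrable (\<alpha> \<star> q) (?T \<alpha>)" if "real_distribution \<alpha>" for \<alpha>
  proof -
    have "?T \<alpha> \<in> borel_measurable (\<alpha> \<star> q)" "(\<lambda>x::real. x) \<in> borel_measurable borel"
      using T[OF that] by simp_all
    from integrable_distr_eq[OF this] assms(4) show ?thesis
      unfolding law_T[OF that] by blast
  qed
  have coupling: "?\<pi> \<alpha> \<in> martingale_couplings (distr \<alpha> borel (?S \<alpha>)) \<nu>"
    if \<alpha>: "real_distribution \<alpha>" "increasing_as \<alpha> (?S \<alpha>)" for \<alpha>
    using martingale_coupling_star_fun[OF \<alpha>(1) assms(5) T[OF \<alpha>(1)] int[OF \<alpha>(1)] \<alpha>(2)] law_T[OF \<alpha>(1)]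
    by simp
  \<comment> \<open>A coupling determines its first marginal, so a Bass martingale from \<open>\<mu>\<close> forces \<open>S\<close> to carry \<open>\<alpha>\<close> to \<open>\<mu>\<close>.\<close>
  have first_marginal: "\<mu> = distr \<alpha> borel (?S \<alpha>)"
    if \<alpha>: "real_distribution \<alpha>" "increasing_as \<alpha> (?S \<alpha>)" "?\<pi> \<alpha> \<in> martingale_couplings \<mu> \<nu>" for \<alpha>
    using that(3) coupling[OF \<alpha>(1,2)] by (simp add: martingale_couplings_def)
  have bass: "(\<exists>\<pi>. q_bass_martingale q \<mu> \<nu> \<pi>) \<longleftrightarrow>
      (\<exists>\<alpha>. real_distribution \<alpha> \<and> distr \<alpha> borel (?S \<alpha>) = \<mu> \<and> increasing_as \<alpha> (?S \<alpha>))"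
    using coupling first_marginal by (auto simp: q_bass_martingale_def Let_def)
  have equation: "(AE u in lborel. 0 < u \<and> u < 1 \<longrightarrow>
        has_bochner_integral lborel
          (\<lambda>z. Q \<nu> (LBINT v=0..1. cdf q (Q \<alpha> u - Q \<alpha> v + z)) * \<rho> z) (Q \<mu> u)) \<longleftrightarrow>
      distr \<alpha> borel (?S \<alpha>) = \<mu>"
    if \<alpha>: "real_distribution \<alpha>" "increasing_as \<alpha> (?S \<alpha>)" for \<alpha>
  proof -
    have "has_bochner_integral lborel
          (\<lambda>z. Q \<nu> (LBINT v=0..1. cdf q (Q \<alpha> u - Q \<alpha> v + z)) * \<rho> z) (Q \<mu> u) \<longleftrightarrow>
        has_bochner_integral q (\<lambda>z. ?T \<alpha> (Q \<alpha> u + z)) (Q \<mu> u)" for u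
    proof -
      have "(\<lambda>z. ?T \<alpha> (Q \<alpha> u + z)) \<in> borel_measurable borel"
        using T[OF \<alpha>(1)] by measurable
      from has_bochner_integral_density_iff[OF this assms(6,7)]
      show ?thesis
        unfolding LBINT_cdf_quantile[OF \<alpha>(1) assms(5)] bass_map_def assms(8)[symmetric] by blast
    qed
    then show ?thesis
      using bass_equation_iff_marginal[OF assms(1,2) \<alpha>(1) assms(5) T[OF \<alpha>(1)] int[OF \<alpha>(1)] \<alpha>(2)]
      by (simp add: AE_leb01_iff)
  qed
  show ?thesis
    unfolding bass using equation by blast
qed

end
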